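(* Let $(I,\mathcal T)$ be a finite tree rooted at $r$ with $\max\{|i|:i\in I\}=n+1$, $n\ge 1$, and let $U$ be a tree matrix on $I$ with associated $q$-matrix $Q$. Let $I^n=\{i\in I:|i|\le n\}$, $\widetilde B^n=\{i\in I:|i|=n,\ S_i\neq\emptyset\}$, $V^{(n)}=-(Q_{I^nI^n})^{-1}$, and let $\mathcal H^n$ be the linear space of $\bar Q^{(n)}$-harmonic functions on $I^n$. Then the matrix $H:=U_{I^nI^n}-V^{(n)}$ is symmetric and its columns generate the space $\mathcal H^n$. Moreover, the columns of $U_{I^n\,\widetilde B^n}$ form a basis of $\mathcal H^n$.
   Context: For a tree rooted at $r$: $|i|$ is the length of the geodesic from $i$ to $r$; $i\wedge j$ is the common vertex of the geodesics from $r$ to $i$ and from $r$ to $j$ that is farthest from $r$; for $i\neq r$, $i^-$ is the neighbour of $i$ closer to $r$; $S_i=\{j: j^-=i\}$. Let $w:\{|i|:i\in I\}\to(0,\infty)$ be strictly increasing and put $w_{-1}=0$. The tree matrix is $U_{ij}=w_{|i\wedge j|}$. The associated symmetric matrix $Q$ is given by $Q_{ii^-}=Q_{i^-i}=(w_{|i|}-w_{|i|-1})^{-1}$ for $i\ne r$; $Q_{ii}=-\big((w_{|i|}-w_{|i|-1})^{-1}+|S_i|(w_{|i|+1}-w_{|i|})^{-1}\big)$ (the second term being absent if $S_i=\emptyset$); $Q_{ij}=0$ otherwise. For a matrix $M$ on $I\times I$ and $J,K\subseteq I$, $M_{JK}$ is its restriction to $J\times K$. The matrix $\bar Q^{(n)}$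 on $I^n\times I^n$ has the same rows as $Q_{I^nI^n}$ for indices in $I^n\setminus\widetilde B^n$, and zero rows for indices in $\widetilde B^n$. A function $h:I^n\to\mathbb R$ is $\bar Q^{(n)}$-harmonic if $\bar Q^{(n)}h=0$. *)

theory Defs
  imports "HOL-Analysis.Analysis"
begin

text \<open>
  The vertex set is a finite type; a graph is given by its adjacency relation.
  A walk is the list of its vertices, so its length is one less than that of the list.
\<close>

type_synonym 'a graph = "'a \<Rightarrow> 'a \<Rightarrow> bool"

definition walk :: "'a graph \<Rightarrow> 'a \<Rightarrow> 'a list \<Rightarrow> 'a \<Rightarrow> bool" where
  "walk E x p y \<longleftrightarrow> p \<noteq> [] \<and> hd p = x \<and> last p = y \<and> successively E p"

definition cycle :: "'a graph \<Rightarrow> 'a list \<Rightarrow> bool" where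
  "cycle E p \<longleftrightarrow> length p \<ge> 3 \<and> distinct p \<and> successively E p \<and> E (last p) (hd p)"

definition tree :: "'a graph \<Rightarrow> bool" where
  "tree E \<longleftrightarrow> symp E \<and> irreflp E \<and> (\<forall>x y. \<exists>p. walk E x p y) \<and> (\<nexists>p. cycle E p)"

text \<open>In a tree there is exactly one shortest walk between two given vertices.\<close>

definition geodesic :: "'a graph \<Rightarrow> 'a \<Rightarrow> 'a \<Rightarrow> 'a list" where
  "geodesic E x y =
    (THE p. walk E x p y \<and> (\<forall>q. walk E x q y \<longrightarrow> length p \<le> length q))"

definition level :: "'a graph \<Rightarrow> 'a \<Rightarrow> 'a \<Rightarrow> nat" where
  "level E r i = length (geodesic E i r) - 1"

definition meet :: "'a graph \<Rightarrow> 'a \<Rightarrow> 'a \<Rightarrow> 'a \<Rightarrow> 'a" where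
  "meet E r i j =
    (ARG_MAX (level E r) k. k \<in> set (geodesic E r i) \<inter> set (geodesic E r j))"

definition parent :: "'a graph \<Rightarrow> 'a \<Rightarrow> 'a \<Rightarrow> 'a" where
  "parent E r i = (THE j. E i j \<and> level E r j < level E r i)"

definition children :: "'a graph \<Rightarrow> 'a \<Rightarrow> 'a \<Rightarrow> 'a set" where
  "children E r i = {j. j \<noteq> r \<and> parent E r j = i}"

text \<open>Only the values of the weight function on the set of levels are relevant.\<close>

definition weight_function :: "'a graph \<Rightarrow> 'a \<Rightarrow> (nat \<Rightarrow> real) \<Rightarrow> bool" where
  "weight_function E r w \<longleftrightarrow>
    (\<forall>k \<in> range (level E r). w k > 0) \<and> strict_mono_on (range (level E r)) w"

text \<open>The difference \<open>w\<^sub>k - w\<^sub>k\<^sub>-\<^sub>1\<close>, with the convention that the weight of level \<open>-1\<close> is zero.\<close>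

definition increment :: "(nat \<Rightarrow> real) \<Rightarrow> nat \<Rightarrow> real" where
  "increment w k = w k - (if k = 0 then 0 else w (k - 1))"

definition tree_matrix :: "'a::finite graph \<Rightarrow> 'a \<Rightarrow> (nat \<Rightarrow> real) \<Rightarrow> real^'a^'a" where
  "tree_matrix E r w = (\<chi> i j. w (level E r (meet E r i j)))"

definition q_matrix :: "'a::finite graph \<Rightarrow> 'a \<Rightarrow> (nat \<Rightarrow> real) \<Rightarrow> real^'a^'a" where
  "q_matrix E r w = (\<chi> i j.
     if i = j then
       - (1 / increment w (level E r i)
          + (if children E r i = {} then 0
             else real (card (children E r i)) / increment w (level E r i + 1)))
     else if i \<noteq> r \<and> j = parent E r i then 1 / increment w (level E r i)
     else if j \<noteq> r \<and> i = parent E r j then 1 / increment w (level E r j)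
     else 0)"

text \<open>
  A \<open>J \<times> K\<close> matrix is represented by the matrix over the whole index type that extends it
  by zero, and a function on \<open>J\<close> by the vector that extends it by zero. These extensions
  respect sums, products, transposes and linear combinations.
\<close>

definition restrict_matrix :: "'a set \<Rightarrow> 'a set \<Rightarrow> real^'a^'a \<Rightarrow> real^'a^'a::finite" where
  "restrict_matrix J K M = (\<chi> i j. if i \<in> J \<and> j \<in> K then M $ i $ j else 0)"

definition functions_on :: "'a set \<Rightarrow> (real^'a::finite) set" where
  "functions_on J = {h. \<forall>i. i \<notin> J \<longrightarrow> h $ i = 0}"

definition is_inverse_on :: "'a set \<Rightarrow> real^'a^'a \<Rightarrow> real^'a^'a::finite \<Rightarrow> bool" where
  "is_inverse_on J M N \<longleftrightarrow> restrict_matrix J J N = N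
     \<and> restrict_matrix J J M ** N = restrict_matrix J J (mat 1)
     \<and> N ** restrict_matrix J J M = restrict_matrix J J (mat 1)"

definition invertible_on :: "'a set \<Rightarrow> real^'a^'a::finite \<Rightarrow> bool" where
  "invertible_on J M \<longleftrightarrow> (\<exists>N. is_inverse_on J M N)"

text \<open>The inverse of the \<open>J \<times> J\<close> block of \<open>M\<close>, meaningful only if \<open>invertible_on J M\<close>.\<close>

definition inverse_on :: "'a set \<Rightarrow> real^'a^'a \<Rightarrow> real^'a^'a::finite" where
  "inverse_on J M = (THE N. is_inverse_on J M N)"

definition levels_upto :: "'a graph \<Rightarrow> 'a \<Rightarrow> nat \<Rightarrow> 'a set" where
  "levels_upto E r n = {i. level E r i \<le> n}"

definition boundary :: "'a graph \<Rightarrow> 'a \<Rightarrow> nat \<Rightarrow> 'a set" where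
  "boundary E r n = {i. level E r i = n \<and> children E r i \<noteq> {}}"

definition q_bar :: "'a::finite graph \<Rightarrow> 'a \<Rightarrow> (nat \<Rightarrow> real) \<Rightarrow> nat \<Rightarrow> real^'a^'a" where
  "q_bar E r w n = (\<chi> i. if i \<in> boundary E r n then 0
     else restrict_matrix (levels_upto E r n) (levels_upto E r n) (q_matrix E r w) $ i)"

definition harmonic_functions ::
    "'a::finite graph \<Rightarrow> 'a \<Rightarrow> (nat \<Rightarrow> real) \<Rightarrow> nat \<Rightarrow> (real^'a) set" where
  "harmonic_functions E r w n =
    {h \<in> functions_on (levels_upto E r n). q_bar E r w n *v h = 0}"

end

theory Submission
  imports Defs
begin

text \<open>
  Write \<open>D\<close> for the discrete gradient along the edges towards the root and \<open>\<Delta>\<close> for the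
  weight increments. Then \<open>x \<bullet> Q y = - (\<Sum>k. D x k * D y k / \<Delta> k)\<close>, while the gradient of
  the \<open>j\<close>-th column of \<open>U\<close> is \<open>\<Delta>\<close> on the ancestors of \<open>j\<close> and zero elsewhere. The first
  fact shows that \<open>Q\<close> is negative definite, so its block on \<open>I\<^sub>n\<close> is invertible. Together they
  telescope to \<open>Q U = - 1 - L U\<close> for the blocks on \<open>I\<^sub>n\<close>, with \<open>L\<close> diagonal and positive
  exactly on \<open>B\<^sub>n\<close>: it comes from the edges that leave \<open>I\<^sub>n\<close>. Hence the block of \<open>U\<close> is
  injective and \<open>Q H = - L U\<close>, so the columns of \<open>H\<close> are harmonic and generate, as \<open>U\<close> is
  onto. The boundary columns of \<open>U\<close> are harmonic and independent, and \<open>Q\<close> maps the harmonic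
  functions injectively into the functions on \<open>B\<^sub>n\<close>, so counting dimensions gives a basis.
\<close>

section \<open>Restricted matrices\<close>

lemma restrict_matrix_mult_vec:
  assumes "x \<in> functions_on K"
  shows "(restrict_matrix J K M *v x) $ i = (if i \<in> J then (M *v x) $ i else 0)"
  using assms
  by (auto simp: matrix_vector_mult_def restrict_matrix_def functions_on_def intro!: sum.cong)

lemma restrict_matrix_mult_vec_in: "restrict_matrix J K M *v x \<in> functions_on J"
  by (simp add: matrix_vector_mult_def restrict_matrix_def functions_on_def)

lemma restrict_matrix_one_mult_vec:
  "x \<in> functions_on J \<Longrightarrow> restrict_matrix J J (mat 1) *v x = x"
  by (auto simp: vec_eq_iff restrict_matrix_mult_vec functions_on_def)

lemma restrict_matrix_restrict_matrix:
  "restrict_matrix J K (restrict_matrix J' K' M) = restrict_matrix (J \<inter> J') (K \<inter> K') M"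
  by (auto simp: restrict_matrix_def vec_eq_iff)

text \<open>The identity block is the coordinate projection onto \<open>J\<close>; block arithmetic
  becomes multiplication by it.\<close>

lemma restrict_matrix_one_mult_left:
  "restrict_matrix J J (mat 1) ** M = restrict_matrix J UNIV M"
proof -
  have "(restrict_matrix J J (mat 1) ** M) $ i $ j
      = (\<Sum>k\<in>UNIV. if k = i then restrict_matrix J UNIV M $ i $ j else 0)" for i j
    unfolding restrict_matrix_def matrix_matrix_mult_def mat_def vec_lambda_beta
    by (intro sum.cong) auto
  then show ?thesis by (simp add: vec_eq_iff)
qed

lemma restrict_matrix_one_mult_right:
  "M ** restrict_matrix K K (mat 1) = restrict_matrix UNIV K M"
proof -
  have "(M ** restrict_matrix K K (mat 1)) $ i $ j
      = (\<Sum>k\<in>UNIV. if k = j then restrict_matrix UNIV K M $ i $ j else 0)" for i j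
    unfolding restrict_matrix_def matrix_matrix_mult_def mat_def vec_lambda_beta
    by (intro sum.cong) auto
  then show ?thesis by (simp add: vec_eq_iff)
qed

lemma subspace_functions_on: "subspace (functions_on J)"
  by (auto simp: subspace_def functions_on_def)

lemma axis_in_functions_on: "axis j 1 \<in> functions_on J \<longleftrightarrow> j \<in> J"
  by (auto simp: functions_on_def axis_def)

lemma mult_vec_in_span_columns:
  fixes A :: "real^'a::finite^'b::finite"
  assumes "x \<in> functions_on K"
  shows "A *v x \<in> span ((\<lambda>j. column j A) ` K)"
proof -
  have "A *v x = (\<Sum>j\<in>K. x $ j *\<^sub>R column j A)"
    unfolding matrix_mult_sum scalar_mult_eq_scaleR using assms
    by (intro sum.mono_neutral_right) (auto simp: functions_on_def)
  then show ?thesis by (simp add: span_sum span_scale span_base)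
qed

section \<open>Inverses of diagonal blocks\<close>

lemma is_inverse_on_mult_vec_in:
  assumes "is_inverse_on J M N"
  shows "N *v x \<in> functions_on J"
  using assms restrict_matrix_mult_vec_in[of J J N x] by (simp add: is_inverse_on_def)

text \<open>The support condition makes the identity block a unit for both inverses, so the usual
  uniqueness argument applies. It justifies the definite description in
  \<open>inverse_on\<close>.\<close>

lemma is_inverse_on_unique:
  assumes "is_inverse_on J M N" "is_inverse_on J M N'"
  shows "N = N'"
proof -
  let ?P = "restrict_matrix J J (mat 1)" and ?M = "restrict_matrix J J M"
  have N: "restrict_matrix J J N = N" "?M ** N = ?P" "N ** ?M = ?P"
    and N': "restrict_matrix J J N' = N'" "?M ** N' = ?P" "N' ** ?M = ?P"
    using assms by (auto simp: is_inverse_on_def)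
  have "N = N ** ?P"
    by (metis N(1) Int_UNIV_left Int_absorb restrict_matrix_one_mult_right
        restrict_matrix_restrict_matrix)
  also have "\<dots> = ?P ** N'" using N(3) N'(2) by (metis matrix_mul_assoc)
  also have "\<dots> = N'"
    by (metis N'(1) Int_UNIV_left Int_absorb restrict_matrix_one_mult_left
        restrict_matrix_restrict_matrix)
  finally show ?thesis .
qed

lemma invertible_on_inverse:
  assumes "invertible_on J M"
  shows "is_inverse_on J M (inverse_on J M)"
  using assms is_inverse_on_unique unfolding inverse_on_def invertible_on_def by (metis theI')

text \<open>The transpose of an inverse inverts the transposed block, so uniqueness carries symmetry
  over.\<close>

lemma transpose_inverse_on:
  assumes "is_inverse_on J M N" "transpose M = M"
  shows "transpose N = N"
proof (rule is_inverse_on_unique[OF _ assms(1)])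
  have T: "transpose (restrict_matrix J J A) = restrict_matrix J J (transpose A)"
    for A :: "real^'b^'b::finite" and J
    by (auto simp: transpose_def restrict_matrix_def vec_eq_iff)
  show "is_inverse_on J M (transpose N)"
    using assms(1) unfolding is_inverse_on_def
    by (metis T matrix_transpose_mul transpose_mat assms(2))
qed

lemma matrix_add_rdistrib: "(A + B) ** C = A ** C + B ** (C :: 'a::semiring_1^_^_)"
  by (simp add: matrix_matrix_mult_def vec_eq_iff distrib_right sum.distrib)

text \<open>Completing the block by an identity block reduces this to full matrices.\<close>

lemma invertible_onI:
  fixes M :: "real^'a^'a::finite"
  assumes "\<And>x. x \<in> functions_on J \<Longrightarrow> restrict_matrix J J M *v x = 0 \<Longrightarrow> x = 0"
  shows "invertible_on J M"
proof -
  define P where "P = restrict_matrix J J (mat 1 :: real^'a^'a)"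
  define P' where "P' = restrict_matrix (-J) (-J) (mat 1 :: real^'a^'a)"
  let ?R = "restrict_matrix J J M"
  define A where "A = ?R + P'"
  have R: "P ** ?R = ?R" "?R ** P = ?R" and P: "P ** P = P"
    by (simp_all add: P_def restrict_matrix_one_mult_left restrict_matrix_one_mult_right
        restrict_matrix_restrict_matrix)
  have orth: "P ** P' = 0" "P' ** P = 0"
    by (auto simp: P_def P'_def restrict_matrix_one_mult_left restrict_matrix_one_mult_right
        restrict_matrix_restrict_matrix) (auto simp: restrict_matrix_def vec_eq_iff)
  have A: "P ** A = ?R" "A ** P = ?R"
    by (simp_all add: A_def matrix_add_ldistrib matrix_add_rdistrib R orth)
  have "x = 0" if x: "A *v x = 0" for x
  proof (rule assms)
    show R0: "?R *v x = 0"
      using matrix_vector_mul_assoc[of P A x] by (simp add: x A)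
    then have "P' *v x = 0" using x by (simp add: A_def matrix_vector_mult_add_rdistrib)
    then have "x $ i = 0" if "i \<notin> J" for i
    proof -
      have "(P' *v x) $ i = (\<Sum>k\<in>UNIV. if k = i then x $ i else 0)"
        unfolding P'_def restrict_matrix_def matrix_vector_mult_def mat_def vec_lambda_beta
        using that by (intro sum.cong) auto
      with \<open>P' *v x = 0\<close> show ?thesis by simp
    qed
    then show "x \<in> functions_on J" by (simp add: functions_on_def)
  qed
  then obtain N where N: "N ** A = mat 1" "A ** N = mat 1"
    using matrix_left_invertible_ker matrix_left_right_inverse by metis
  \<comment> \<open>Compressing the full inverse by \<open>P\<close> on both sides yields an inverse
    supported on \<open>J\<close>.\<close>
  have "?R ** (P ** N ** P) = P ** (A ** N) ** P" "(P ** N ** P) ** ?R = P ** (N ** A) ** P"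
  proof -
    have "?R ** (P ** N ** P) = (?R ** P) ** N ** P" by (simp only: matrix_mul_assoc)
    also have "\<dots> = P ** (A ** N) ** P" by (simp only: R A matrix_mul_assoc)
    finally show "?R ** (P ** N ** P) = P ** (A ** N) ** P" .
    have "(P ** N ** P) ** ?R = P ** N ** (P ** ?R)" by (simp only: matrix_mul_assoc)
    also have "\<dots> = P ** N ** (A ** P)" by (simp only: R A)
    also have "\<dots> = P ** (N ** A) ** P" by (simp only: matrix_mul_assoc)
    finally show "(P ** N ** P) ** ?R = P ** (N ** A) ** P" .
  qed
  then have "?R ** (P ** N ** P) = P" "(P ** N ** P) ** ?R = P"
    by (simp_all add: N P)
  moreover have "restrict_matrix J J (P ** N ** P) = P ** N ** P"
    by (simp add: P_def restrict_matrix_one_mult_left restrict_matrix_one_mult_right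
        restrict_matrix_restrict_matrix)
  ultimately show ?thesis unfolding invertible_on_def is_inverse_on_def P_def by blast
qed

section \<open>Shortest walks in trees\<close>

text \<open>The property inside the definite description of \<open>geodesic\<close>, named for use
  before uniqueness is known.\<close>

definition shortest :: "'a graph \<Rightarrow> 'a \<Rightarrow> 'a list \<Rightarrow> 'a \<Rightarrow> bool" where
  "shortest E x p y \<longleftrightarrow> walk E x p y \<and> (\<forall>q. walk E x q y \<longrightarrow> length p \<le> length q)"

lemma walk_append_iff:
  "walk E x (p @ z # q) y \<longleftrightarrow> walk E x (p @ [z]) z \<and> walk E z (z # q) y"
  by (auto simp: walk_def successively_append_iff hd_append split: if_splits)

lemma walk_snocD: "walk E x p y \<Longrightarrow> \<exists>p'. p = p' @ [y]"
  by (metis walk_def append_butlast_last_id)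

lemma walk_ConsD: "walk E x p y \<Longrightarrow> \<exists>p'. p = x # p'"
  by (metis walk_def list.collapse)

lemma walk_rev: "symp E \<Longrightarrow> walk E x p y \<Longrightarrow> walk E y (rev p) x"
  by (auto simp: walk_def hd_rev last_rev successively_rev elim: successively_mono dest: sympD)

text \<open>A shorter replacement for one piece, glued to the other piece, would shorten the whole
  walk.\<close>

lemma shortest_appendD:
  assumes "shortest E x (p @ z # q) y"
  shows "shortest E x (p @ [z]) z" "shortest E z (z # q) y"
proof -
  have w: "walk E x (p @ [z]) z" "walk E z (z # q) y"
    using assms walk_append_iff[of E x p z q y] by (auto simp: shortest_def)
  have min: "length (p @ z # q) \<le> length s" if "walk E x s y" for s
    using assms that by (auto simp: shortest_def)
  have "length (p @ [z]) \<le> length s" if s: "walk E x s z" for s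
  proof -
    obtain s' where "s = s' @ [z]" using walk_snocD[OF s] by blast
    with min[of "s' @ z # q"] walk_append_iff[of E x s' z q y] s w show ?thesis by auto
  qed
  with w show "shortest E x (p @ [z]) z" by (auto simp: shortest_def)
  have "length (z # q) \<le> length s" if s: "walk E z s y" for s
  proof -
    obtain s' where "s = z # s'" using walk_ConsD[OF s] by blast
    with min[of "p @ z # s'"] walk_append_iff[of E x p z s' y] s w show ?thesis by auto
  qed
  with w show "shortest E z (z # q) y" by (auto simp: shortest_def)
qed

text \<open>A repeated vertex encloses a detour; cutting it out leaves a shorter walk with the same
  ends.\<close>

lemma shortest_distinct:
  assumes "shortest E x p y"
  shows "distinct p"
proof (rule ccontr)
  assume "\<not> distinct p"
  then obtain a z b c where p: "p = a @ [z] @ b @ [z] @ c" using not_distinct_decomp by blast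
  have "walk E x (a @ z # b @ z # c) y" using assms p by (simp add: shortest_def)
  then have "walk E x (a @ [z]) z" "walk E z (z # c) y"
    using walk_append_iff[of E x a z "b @ z # c"] walk_append_iff[of E z "z # b" z c] by auto
  then have "walk E x (a @ z # c) y" using walk_append_iff by metis
  with assms p show False by (fastforce simp: shortest_def)
qed

lemma shortest_refl: "shortest E x p x \<longleftrightarrow> p = [x]"
proof
  assume p: "shortest E x p x"
  have "walk E x [x] x" by (simp add: walk_def)
  with p have "length p \<le> 1" "walk E x p x" by (fastforce simp: shortest_def)+
  then show "p = [x]" by (cases p) (auto simp: walk_def)
next
  show "p = [x] \<Longrightarrow> shortest E x p x"
    by (auto simp: shortest_def walk_def Suc_le_eq)
qed

text \<open>Two distinct shortest walks of minimal length meet only in their ends, so together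
  they form a cycle.\<close>

lemma shortest_unique:
  assumes "tree E" "shortest E x p y" "shortest E x q y"
  shows "p = q"
  using assms(2,3)
proof (induction "length p" arbitrary: x y p q rule: less_induct)
  case less
  have len: "length p = length q"
    using less.prems by (auto simp: shortest_def intro: antisym)
  have wp: "walk E x p y" and wq: "walk E x q y"
    using less.prems by (auto simp: shortest_def)
  show ?case
  proof (cases "\<exists>z. z \<in> set p \<and> z \<in> set q \<and> z \<noteq> x \<and> z \<noteq> y")
    \<comment> \<open>At a common inner vertex both walks split into shortest walks, those from
      \<open>p\<close> being strictly shorter, so induction applies.\<close>
    case True
    then obtain z p1 p2 q1 q2 where z: "z \<noteq> x" "z \<noteq> y"
      and p: "p = p1 @ z # p2" and q: "q = q1 @ z # q2"
      by (metis split_list)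
    have "p1 \<noteq> []" "p2 \<noteq> []" using z wp by (auto simp: p walk_def)
    then have "length (p1 @ [z]) < length p" "length (z # p2) < length p" by (auto simp: p)
    with less.hyps shortest_appendD less.prems have "p1 @ [z] = q1 @ [z]" "z # p2 = z # q2"
      unfolding p q by metis+
    then show ?thesis by (simp add: p q)
  next
    case False
    show ?thesis
    proof (cases "x = y")
      case True
      then show ?thesis using less.prems by (simp add: shortest_refl)
    next
      case xy: False
      obtain ps where p: "p = x # ps @ [y]"
        using walk_ConsD[OF wp] walk_snocD[OF wp] xy by (metis append_eq_Cons_conv list.inject)
      obtain qs where q: "q = x # qs @ [y]"
        using walk_ConsD[OF wq] walk_snocD[OF wq] xy by (metis append_eq_Cons_conv list.inject)
      show ?thesis
      proof (rule ccontr)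
        assume "p \<noteq> q"
        \<comment> \<open>The lengths agree, so one empty interior would make both walks equal to
          \<open>[x, y]\<close>.\<close>
        with len p q have ne: "ps \<noteq> []" "qs \<noteq> []" by auto
        have "symp E" using assms(1) by (simp add: tree_def)
        then have "walk E y (rev q) x" using wq by (rule walk_rev)
        then have sq: "successively E (y # rev qs)" "E (last (y # rev qs)) x"
          using ne by (auto simp: q walk_def successively_append_iff successively_Cons)
        have "distinct p" "distinct q" using less.prems by (auto intro: shortest_distinct)
        \<comment> \<open>The interiors are disjoint in this case, so going along \<open>p\<close>
          and back along \<open>q\<close> repeats no vertex.\<close>
        then have "distinct (x # ps @ y # rev qs)"
          using False by (auto simp: p q)
        moreover have "successively E (x # ps @ y # rev qs)"
          using wp sq by (auto simp: p walk_def successively_append_iff successively_Cons hd_append)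
        ultimately have "cycle E (x # ps @ y # rev qs)"
          using sq ne by (auto simp: cycle_def Suc_le_eq)
        with assms(1) show False by (auto simp: tree_def)
      qed
    qed
  qed
qed

section \<open>Rooted trees\<close>

locale rooted_tree =
  fixes E :: "'a graph" and r :: 'a
  assumes tree: "tree E"
begin

text \<open>Connectedness supplies a walk, well-ordering a shortest one, and acyclicity its
  uniqueness.\<close>

lemma shortest_geodesic: "shortest E x (geodesic E x y) y"
proof -
  obtain p where "walk E x p y" using tree unfolding tree_def by blast
  then have "\<exists>p. shortest E x p y"
    using ex_has_least_nat[of "\<lambda>p. walk E x p y" p length] by (auto simp: shortest_def)
  then have "\<exists>!p. shortest E x p y" using shortest_unique[OF tree] by blast
  from theI'[OF this] show ?thesis by (simp add: geodesic_def shortest_def)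
qed

lemma geodesic_eqI: "shortest E x p y \<Longrightarrow> geodesic E x y = p"
  using shortest_unique[OF tree shortest_geodesic] .

lemma walk_geodesic: "walk E x (geodesic E x y) y"
  using shortest_geodesic by (simp add: shortest_def)

text \<open>\<open>level\<close> reads geodesics towards the root and \<open>meet\<close> away from
  it; this links the two.\<close>

lemma geodesic_rev: "geodesic E x y = rev (geodesic E y x)"
proof (rule geodesic_eqI)
  have "symp E" using tree by (simp add: tree_def)
  then show "shortest E x (rev (geodesic E y x)) y"
    using shortest_geodesic[of y x] walk_rev by (fastforce simp: shortest_def)
qed

section \<open>Parents, levels and ancestors\<close>

abbreviation lev :: "'a \<Rightarrow> nat" where "lev \<equiv> level E r"
abbreviation par :: "'a \<Rightarrow> 'a" where "par \<equiv> parent E r"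
abbreviation anc :: "'a \<Rightarrow> 'a set" where "anc i \<equiv> set (geodesic E r i)"

text \<open>The second vertex of the geodesic is the only neighbour at a smaller level. This makes
  levels and ancestors recursive in \<open>par\<close>.\<close>

lemma geodesic_parent:
  assumes "i \<noteq> r"
  shows "geodesic E i r = i # geodesic E (par i) r"
proof -
  have len: "length (geodesic E j r) = Suc (lev j)" for j
    using walk_ConsD[OF walk_geodesic] by (metis level_def diff_Suc_1 length_Cons)
  obtain j p where g: "geodesic E i r = i # j # p"
    using walk_ConsD[OF walk_geodesic[of i r]] walk_geodesic[of i r] assms
    by (metis walk_def last_ConsL neq_Nil_conv)
  have "shortest E j (j # p) r"
    using shortest_appendD(2)[of E i "[i]" j p r] shortest_geodesic[of i r] g by simp
  then have gj: "geodesic E j r = j # p" by (rule geodesic_eqI)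
  have "par i = j"
    unfolding parent_def
  proof (rule the_equality)
    show "E i j \<and> lev j < lev i"
      using walk_geodesic[of i r] g gj by (simp add: walk_def level_def)
  next
    fix k assume k: "E i k \<and> lev k < lev i"
    \<comment> \<open>Through a lower neighbour \<open>k\<close> runs a walk no longer than the
      geodesic, hence the geodesic itself by uniqueness.\<close>
    have "walk E i (i # geodesic E k r) r"
      using walk_geodesic[of k r] k by (auto simp: walk_def successively_Cons)
    moreover have "length (i # geodesic E k r) \<le> length (geodesic E i r)"
      using k by (simp add: len)
    ultimately have "shortest E i (i # geodesic E k r) r"
      using shortest_geodesic[of i r] by (fastforce simp: shortest_def)
    then have "geodesic E k r = j # p" using geodesic_eqI g by force
    then show "k = j" using walk_geodesic[of k r] by (simp add: walk_def)
  qed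
  with g gj show ?thesis by simp
qed

lemma geodesic_root: "geodesic E r r = [r]"
  by (rule geodesic_eqI) (simp add: shortest_refl)

lemma level_root: "lev r = 0"
  by (simp add: level_def geodesic_root)

lemma level_parent: "i \<noteq> r \<Longrightarrow> lev i = Suc (lev (par i))"
  using walk_ConsD[OF walk_geodesic[of "par i" r]] by (auto simp: level_def geodesic_parent)

lemma ancestors_root: "anc r = {r}"
  by (simp add: geodesic_root)

lemma ancestors_parent: "i \<noteq> r \<Longrightarrow> anc i = insert i (anc (par i))"
  using geodesic_rev[of r i] geodesic_rev[of r "par i"] by (simp add: geodesic_parent)

lemma tree_induct [case_names root parent]:
  assumes "P r" and "\<And>i. i \<noteq> r \<Longrightarrow> P (par i) \<Longrightarrow> P i"
  shows "P i"
proof (induction "lev i" arbitrary: i)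
  case 0
  then show ?case using assms(1) level_parent by (metis nat.distinct(1))
next
  case (Suc k)
  then show ?case using assms level_parent by (metis nat.inject)
qed

lemma self_ancestor: "i \<in> anc i"
  by (cases "i = r") (auto simp: ancestors_root ancestors_parent)

lemma ancestor_level: "k \<in> anc i \<Longrightarrow> k = i \<or> lev k < lev i"
proof (induction i rule: tree_induct)
  case root
  then show ?case by (simp add: ancestors_root)
next
  case (parent i)
  then show ?case using level_parent[of i] by (auto simp: ancestors_parent)
qed

lemma ancestor_trans: "k \<in> anc i \<Longrightarrow> anc k \<subseteq> anc i"
proof (induction i rule: tree_induct)
  case root
  then show ?case by (simp add: ancestors_root)
next
  case (parent i)
  then show ?case by (auto simp: ancestors_parent)
qed

lemma root_ancestor: "r \<in> anc i"
  by (induction i rule: tree_induct) (auto simp: ancestors_root ancestors_parent)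

lemma not_ancestor_parent: "i \<noteq> r \<Longrightarrow> i \<notin> anc (par i)"
  using ancestor_level[of i "par i"] level_parent[of i] by fastforce

text \<open>The tree matrix sees a meet only through its level. The root is a common ancestor, so
  the maximum exists.\<close>

lemma level_meet: "lev (meet E r i j) = Max (lev ` (anc i \<inter> anc j))"
proof -
  let ?S = "anc i \<inter> anc j"
  have fin: "finite ?S" and "?S \<noteq> {}" using root_ancestor by auto
  then have "Max (lev ` ?S) \<in> lev ` ?S" by simp
  then obtain k where k: "k \<in> ?S" "lev k = Max (lev ` ?S)" by auto
  have "lev (meet E r i j) = lev k"
    unfolding meet_def
    by (rule arg_max_equality) (use k fin in \<open>auto simp del: Int_iff\<close>)
  with k show ?thesis by simp
qed

text \<open>Compares a column of the tree matrix at the two ends of an edge: passing from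
  \<open>i\<close> to its parent removes only \<open>i\<close> from the ancestors.\<close>

lemma level_meet_parent:
  assumes "i \<noteq> r"
  shows "i \<in> anc j \<Longrightarrow> lev (meet E r i j) = lev i"
    and "i \<in> anc j \<Longrightarrow> lev (meet E r (par i) j) = lev (par i)"
    and "i \<notin> anc j \<Longrightarrow> lev (meet E r i j) = lev (meet E r (par i) j)"
proof -
  have sub: "lev (meet E r k j) = lev k" if "k \<in> anc j" for k
  proof -
    have "anc k \<inter> anc j = anc k" using ancestor_trans[OF that] by blast
    then show ?thesis
      unfolding level_meet using self_ancestor[of k] ancestor_level[of _ k]
      by (auto intro!: Max_eqI dest: ancestor_level)
  qed
  show "i \<in> anc j \<Longrightarrow> lev (meet E r i j) = lev i" by (rule sub)
  show "i \<in> anc j \<Longrightarrow> lev (meet E r (par i) j) = lev (par i)"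
    using sub ancestor_trans[of i j] self_ancestor[of "par i"] ancestors_parent[OF assms] by blast
  show "i \<notin> anc j \<Longrightarrow> lev (meet E r i j) = lev (meet E r (par i) j)"
    unfolding level_meet ancestors_parent[OF assms] by simp
qed

end

section \<open>The tree matrix and its q-matrix\<close>

text \<open>Each vertex other than the root is a child of exactly one vertex, so the double sum runs
  over the edges.\<close>

lemma sum_children:
  fixes f :: "'a::finite \<Rightarrow> 'a \<Rightarrow> 'b::comm_monoid_add"
  shows "(\<Sum>i\<in>UNIV. \<Sum>c\<in>children E r i. f i c) = (\<Sum>c\<in>-{r}. f (parent E r c) c)"
proof -
  have "(\<Sum>i\<in>UNIV. \<Sum>c\<in>children E r i. f i c)
      = (\<Sum>i\<in>UNIV. \<Sum>c\<in>{c \<in> -{r}. parent E r c = i}. f (parent E r c) c)"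
    by (intro sum.cong) (auto simp: children_def)
  also have "\<dots> = (\<Sum>c\<in>-{r}. f (parent E r c) c)"
    by (rule sum.group) auto
  finally show ?thesis .
qed

locale weighted_tree = rooted_tree E r for E :: "'a::finite graph" and r +
  fixes w :: "nat \<Rightarrow> real"
  assumes weights: "weight_function E r w"
begin

abbreviation inc :: "'a \<Rightarrow> real" where "inc i \<equiv> increment w (lev i)"

text \<open>At the root the increment is \<open>w 0\<close>; elsewhere both consecutive levels are
  attained, so strict monotonicity applies.\<close>

lemma inc_pos: "inc i > 0"
proof (cases "i = r")
  case True
  then show ?thesis
    using weights by (auto simp: weight_function_def increment_def level_root dest: spec[of _ r])
next
  case False
  have "strict_mono_on (range lev) w" using weights by (simp add: weight_function_def)
  then have "w (lev (par i)) < w (lev i)"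
    by (rule strict_mono_onD) (simp_all, simp add: level_parent[OF False])
  then show ?thesis using level_parent[OF False] by (simp add: increment_def)
qed

text \<open>\<open>par r\<close> is unspecified; the value 0 above the root matches the convention
  that the weight of level -1 is zero.\<close>

definition grad :: "real^'a \<Rightarrow> 'a \<Rightarrow> real" where
  "grad x k = x $ k - (if k = r then 0 else x $ par k)"

text \<open>Telescoping along the path to the root; it recovers a function from its
  gradient.\<close>

lemma sum_grad_ancestors: "(\<Sum>k\<in>anc j. grad x k) = x $ j"
proof (induction j rule: tree_induct)
  case root
  then show ?case by (simp add: ancestors_root grad_def)
next
  case (parent j)
  then show ?case by (simp add: ancestors_parent not_ancestor_parent grad_def)
qed

lemma grad_eq_0D:
  assumes "\<And>k. grad x k = 0"
  shows "x = 0"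
  using assms sum_grad_ancestors[of x] by (simp add: vec_eq_iff)

lemma tree_matrix_sym: "tree_matrix E r w $ i $ j = tree_matrix E r w $ j $ i"
  by (simp add: tree_matrix_def level_meet Int_commute)

text \<open>Going from \<open>par k\<close> to \<open>k\<close> raises the level of the meet with
  \<open>j\<close> by one if \<open>k\<close> is an ancestor of \<open>j\<close>, and keeps it
  otherwise; at the root the gradient is \<open>w 0\<close>.\<close>

lemma grad_tree_matrix:
  "grad (column j (tree_matrix E r w)) k = (if k \<in> anc j then inc k else 0)"
proof (cases "k = r")
  case True
  have "anc r \<inter> anc j = {r}" using root_ancestor by (simp add: ancestors_root)
  then have "lev (meet E r r j) = 0" by (simp add: level_meet level_root)
  then show ?thesis
    using True root_ancestor
    by (simp add: grad_def column_def tree_matrix_def increment_def level_root)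
next
  case False
  then show ?thesis
    using level_meet_parent[OF False, of j] level_parent[OF False]
    by (auto simp: grad_def column_def tree_matrix_def increment_def)
qed

text \<open>The off-diagonal cases exclude one another, so they can be added and then summed
  separately. All children of \<open>i\<close> share one level, which turns their count into a
  sum.\<close>

lemma q_matrix_entry:
  "q_matrix E r w $ i $ j =
    (if i = j then - 1 / inc i - (\<Sum>c\<in>children E r i. 1 / inc c) else 0)
    + (if i \<noteq> r \<and> j = par i then 1 / inc i else 0)
    + (if j \<noteq> r \<and> i = par j then 1 / inc j else 0)"
proof -
  have "inc c = increment w (lev i + 1)" if "c \<in> children E r i" for c
    using that level_parent by (auto simp: children_def)
  then have "(\<Sum>c\<in>children E r i. 1 / inc c)
      = real (card (children E r i)) / increment w (lev i + 1)"
    by simp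
  moreover have "par k \<noteq> k" if "k \<noteq> r" for k using level_parent[OF that] by auto
  moreover have "\<not> (i \<noteq> r \<and> j = par i \<and> j \<noteq> r \<and> i = par j)"
    using level_parent[of i] level_parent[of j] by auto
  ultimately show ?thesis by (auto simp: q_matrix_def)
qed

lemma q_matrix_sym: "q_matrix E r w $ i $ j = q_matrix E r w $ j $ i"
  by (auto simp: q_matrix_entry)

text \<open>The Dirichlet form of the network with conductance \<open>1 / inc k\<close> on the edge above \<open>k\<close>;
  above the root this edge leads to a cemetery, where all functions vanish.\<close>

lemma inner_q_matrix:
  "x \<bullet> (q_matrix E r w *v y) = - (\<Sum>k\<in>UNIV. grad x k * grad y k / inc k)"
proof -
  have "x \<bullet> (q_matrix E r w *v y) = (\<Sum>i\<in>UNIV. \<Sum>j\<in>UNIV. x $ i * q_matrix E r w $ i $ j * y $ j)"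
    by (simp add: inner_vec_def matrix_vector_mult_def sum_distrib_left mult.assoc)
  also have "\<dots> = (\<Sum>i\<in>UNIV. \<Sum>j\<in>UNIV.
       (if j = i then - (x $ i * y $ i / inc i) - (\<Sum>c\<in>children E r i. x $ i * y $ i / inc c) else 0)
       + (if j = par i then if i \<noteq> r then x $ i * y $ par i / inc i else 0 else 0)
       + (if i = par j then if j \<noteq> r then x $ par j * y $ j / inc j else 0 else 0))"
    by (intro sum.cong refl)
      (auto simp: q_matrix_entry algebra_simps sum_distrib_left sum_distrib_right divide_simps)
  also have "\<dots> = (\<Sum>i\<in>UNIV. - (x $ i * y $ i / inc i) - (\<Sum>c\<in>children E r i. x $ i * y $ i / inc c))
       + (\<Sum>i\<in>UNIV. if i \<noteq> r then x $ i * y $ par i / inc i else 0)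
       + (\<Sum>i\<in>UNIV. \<Sum>j\<in>UNIV. if i = par j then if j \<noteq> r then x $ par j * y $ j / inc j else 0 else 0)"
    by (simp add: sum.distrib)
  also have "(\<Sum>i\<in>UNIV. \<Sum>j\<in>UNIV. if i = par j then if j \<noteq> r then x $ par j * y $ j / inc j else 0 else 0)
       = (\<Sum>j\<in>UNIV. if j \<noteq> r then x $ par j * y $ j / inc j else 0)"
    by (subst sum.swap) simp
  also have "(\<Sum>i\<in>UNIV. - (x $ i * y $ i / inc i) - (\<Sum>c\<in>children E r i. x $ i * y $ i / inc c))
       = - (\<Sum>i\<in>UNIV. x $ i * y $ i / inc i) - (\<Sum>k\<in>-{r}. x $ par k * y $ par k / inc k)"
    by (simp only: sum_subtractf sum_negf sum_children)
  also have "(\<Sum>k\<in>-{r}. x $ par k * y $ par k / inc k)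
       = (\<Sum>k\<in>UNIV. if k \<noteq> r then x $ par k * y $ par k / inc k else 0)"
    by (rule sum.mono_neutral_cong_left) auto
  \<comment> \<open>Vertex by vertex, the four terms expand
    \<open>- grad x k * grad y k / inc k\<close>; at the root only the first is present.\<close>
  finally show ?thesis
    by (simp flip: sum_negf sum_subtractf sum.distrib)
      (auto simp: grad_def algebra_simps diff_divide_distrib add_divide_distrib intro!: sum.cong)
qed

section \<open>Harmonic functions\<close>

text \<open>The diagonal entries of the matrix \<open>L\<close> in the header.\<close>

definition leak :: "nat \<Rightarrow> 'a \<Rightarrow> real" where
  "leak n i = (\<Sum>c\<in>children E r i - levels_upto E r n. 1 / inc c)"

lemma children_level: "c \<in> children E r i \<Longrightarrow> lev c = Suc (lev i)"
  using level_parent by (auto simp: children_def)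

lemma leak_pos:
  assumes "i \<in> boundary E r n"
  shows "leak n i > 0"
proof -
  have "children E r i - levels_upto E r n = children E r i"
    using assms children_level by (auto simp: boundary_def levels_upto_def)
  then show ?thesis
    using assms inc_pos by (auto simp: leak_def boundary_def intro!: sum_pos)
qed

text \<open>Such a vertex has no children, or its level is less than \<open>n\<close> and its
  children stay in \<open>I\<^sub>n\<close>.\<close>

lemma leak_eq_0:
  assumes "i \<in> levels_upto E r n" "i \<notin> boundary E r n"
  shows "leak n i = 0"
proof -
  have "children E r i - levels_upto E r n = {}"
    using assms children_level[of _ i] by (fastforce simp: boundary_def levels_upto_def)
  then show ?thesis unfolding leak_def by (simp only: sum.empty)
qed

section \<open>The product of the two blocks and its consequences for their kernels\<close>

abbreviation q_block :: "nat \<Rightarrow> real^'a^'a" where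
  "q_block n \<equiv> restrict_matrix (levels_upto E r n) (levels_upto E r n) (q_matrix E r w)"

abbreviation u_block :: "nat \<Rightarrow> real^'a^'a" where
  "u_block n \<equiv> restrict_matrix (levels_upto E r n) (levels_upto E r n) (tree_matrix E r w)"

abbreviation one_block :: "nat \<Rightarrow> real^'a^'a" where
  "one_block n \<equiv> restrict_matrix (levels_upto E r n) (levels_upto E r n) (mat 1)"

text \<open>The entry is the Dirichlet form of a unit vector and a truncated column of
  \<open>U\<close>. Inside \<open>I\<^sub>n\<close> the increments cancel and the gradients
  telescope; on edges leaving it the truncated column drops to 0, which produces the leak.\<close>

lemma q_block_mult_u_block:
  "(q_block n ** u_block n) $ i $ j = - one_block n $ i $ j - leak n i * u_block n $ i $ j"
proof (cases "i \<in> levels_upto E r n \<and> j \<in> levels_upto E r n")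
  case False
  then show ?thesis by (auto simp: restrict_matrix_def matrix_matrix_mult_def)
next
  case True
  let ?J = "levels_upto E r n"
  let ?x = "axis i 1" and ?y = "column j (u_block n)"
  have anc_J: "k \<in> ?J" if "k \<in> anc j" for k
    using ancestor_level[OF that] True by (auto simp: levels_upto_def)
  have summand: "grad ?x k * grad ?y k / inc k
      = (if k \<in> anc j then grad ?x k else 0)
        + (if k \<in> children E r i - ?J then u_block n $ i $ j / inc k else 0)" for k
  proof (cases "k \<in> ?J")
    case k: True
    then have "par k \<in> ?J" if "k \<noteq> r"
      using level_parent[OF that] by (simp add: levels_upto_def)
    with k True have "grad ?y k = grad (column j (tree_matrix E r w)) k"
      by (auto simp: grad_def column_def restrict_matrix_def)
    then show ?thesis using k inc_pos[of k] by (simp add: grad_tree_matrix)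
  next
    \<comment> \<open>Both functions vanish at \<open>k\<close>, so the two minus signs cancel and
      the values at \<open>par k\<close> are multiplied; the unit vector selects the children of
      \<open>i\<close>.\<close>
    case k: False
    then have "k \<noteq> r" by (auto simp: levels_upto_def level_root)
    moreover have "k \<notin> anc j" "k \<noteq> i" using k anc_J True by auto
    ultimately show ?thesis
      using k by (auto simp: grad_def column_def restrict_matrix_def axis_def children_def)
  qed
  have "(q_block n ** u_block n) $ i $ j = (q_matrix E r w *v ?y) $ i"
    using True
    by (auto simp: matrix_matrix_mult_def matrix_vector_mult_def restrict_matrix_def column_def
        intro!: sum.cong)
  also have "\<dots> = ?x \<bullet> (q_matrix E r w *v ?y)"
    by (simp add: inner_axis')
  also have "\<dots> = - (\<Sum>k\<in>UNIV. if k \<in> anc j then grad ?x k else 0)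
      - (\<Sum>k\<in>UNIV. if k \<in> children E r i - ?J then u_block n $ i $ j / inc k else 0)"
    unfolding inner_q_matrix summand by (simp add: sum.distrib)
  also have "(\<Sum>k\<in>UNIV. if k \<in> anc j then grad ?x k else 0) = ?x $ j"
    by (simp flip: sum.inter_filter add: sum_grad_ancestors)
  also have "(\<Sum>k\<in>UNIV. if k \<in> children E r i - ?J then u_block n $ i $ j / inc k else 0)
      = leak n i * u_block n $ i $ j"
    unfolding leak_def sum_distrib_right by (rule sum.mono_neutral_cong_right) auto
  also have "?x $ j = one_block n $ i $ j"
    using True by (auto simp: axis_def restrict_matrix_def mat_def)
  finally show ?thesis .
qed

lemma q_block_mult_u_block_vec:
  "(q_block n *v (u_block n *v x)) $ i
    = - (one_block n *v x) $ i - leak n i * (u_block n *v x) $ i"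
  unfolding matrix_vector_mul_assoc
  by (simp add: matrix_vector_mult_def q_block_mult_u_block left_diff_distrib sum_subtractf
      sum_negf sum_distrib_left mult.assoc)

text \<open>Pairing with \<open>x\<close> gives a vanishing sum of squared gradients with positive
  weights.\<close>

lemma q_block_kernel:
  assumes "x \<in> functions_on (levels_upto E r n)" "q_block n *v x = 0"
  shows "x = 0"
proof (rule grad_eq_0D)
  fix k
  have "(q_matrix E r w *v x) $ i = 0" if "i \<in> levels_upto E r n" for i
    using restrict_matrix_mult_vec[OF assms(1), of "levels_upto E r n" "q_matrix E r w" i]
      assms(2) that by simp
  then have "x $ i * (q_matrix E r w *v x) $ i = 0" for i
    using assms(1) by (cases "i \<in> levels_upto E r n") (auto simp: functions_on_def)
  then have "x \<bullet> (q_matrix E r w *v x) = 0"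
    unfolding inner_vec_def inner_real_def by (intro sum.neutral ballI)
  then have "(\<Sum>k\<in>UNIV. grad x k * grad x k / inc k) = 0"
    by (simp add: inner_q_matrix)
  moreover have "0 \<le> grad x k * grad x k / inc k" for k
    using inc_pos[of k] by simp
  ultimately have "grad x k * grad x k / inc k = 0"
    by (simp add: sum_nonneg_eq_0_iff)
  then show "grad x k = 0" using inc_pos[of k] by simp
qed

lemma u_block_kernel:
  assumes "x \<in> functions_on (levels_upto E r n)" "u_block n *v x = 0"
  shows "x = 0"
proof -
  have "(one_block n *v x) $ i = 0" for i
    using q_block_mult_u_block_vec[of n x i] assms(2) by simp
  then show ?thesis using restrict_matrix_one_mult_vec[OF assms(1)] by (simp add: vec_eq_iff)
qed

section \<open>The space of harmonic functions\<close>

lemma boundary_subset: "boundary E r n \<subseteq> levels_upto E r n"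
  by (auto simp: boundary_def levels_upto_def)

text \<open>\<open>q_bar\<close> blanks the boundary rows of the block, so harmonicity is a support
  condition on the image under the full block.\<close>

lemma harmonic_iff:
  "h \<in> harmonic_functions E r w n \<longleftrightarrow>
    h \<in> functions_on (levels_upto E r n) \<and> q_block n *v h \<in> functions_on (boundary E r n)"
  by (auto simp: harmonic_functions_def q_bar_def functions_on_def vec_eq_iff
      matrix_vector_mult_def)

lemma subspace_harmonic: "subspace (harmonic_functions E r w n)"
  using subspace_functions_on[of "levels_upto E r n"] subspace_functions_on[of "boundary E r n"]
  by (auto simp: subspace_def harmonic_iff matrix_vector_right_distrib matrix_vector_mult_scaleR)

lemma column_u_block_harmonic:
  assumes "j \<in> boundary E r n"
  shows "column j (u_block n) \<in> harmonic_functions E r w n"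
  unfolding harmonic_iff
proof
  show "column j (u_block n) \<in> functions_on (levels_upto E r n)"
    by (simp add: functions_on_def column_def restrict_matrix_def)
  have "(q_block n *v column j (u_block n)) $ i = 0" if "i \<notin> boundary E r n" for i
  proof -
    have "(q_block n *v column j (u_block n)) $ i = (q_block n ** u_block n) $ i $ j"
      by (simp add: matrix_vector_mult_def matrix_matrix_mult_def column_def)
    also have "\<dots> = - one_block n $ i $ j - leak n i * u_block n $ i $ j"
      by (rule q_block_mult_u_block)
    \<comment> \<open>Here \<open>i\<close> and \<open>j\<close> differ, as only \<open>j\<close> is
      a boundary vertex; the leak is 0 inside \<open>I\<^sub>n\<close> and the entry of
      \<open>u_block n\<close> is 0 outside.\<close>
    also have "\<dots> = 0"
      using assms that leak_eq_0[of i n] by (auto simp: restrict_matrix_def mat_def)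
    finally show ?thesis .
  qed
  then show "q_block n *v column j (u_block n) \<in> functions_on (boundary E r n)"
    by (simp add: functions_on_def)
qed

lemma transpose_blocks:
  "transpose (q_matrix E r w) = q_matrix E r w" "transpose (u_block n) = u_block n"
  using q_matrix_sym tree_matrix_sym by (auto simp: transpose_def vec_eq_iff restrict_matrix_def)

lemma invertible_q_block: "invertible_on (levels_upto E r n) (q_matrix E r w)"
  by (rule invertible_onI) (rule q_block_kernel)

lemma invertible_u_block: "invertible_on (levels_upto E r n) (tree_matrix E r w)"
  by (rule invertible_onI) (rule u_block_kernel)

text \<open>\<open>N\<close> recovers \<open>h\<close> from \<open>q_block n *v h\<close>, which
  lives on the boundary. This bounds the dimension by the number of boundary vertices.\<close>

lemma harmonic_span_inverse:
  assumes "is_inverse_on (levels_upto E r n) (q_matrix E r w) N"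
  shows "harmonic_functions E r w n \<subseteq> span ((\<lambda>j. column j N) ` boundary E r n)"
proof
  fix h assume h: "h \<in> harmonic_functions E r w n"
  then have "N *v (q_block n *v h) = h"
    using assms by (simp add: harmonic_iff is_inverse_on_def matrix_vector_mul_assoc
        restrict_matrix_one_mult_vec)
  moreover have "q_block n *v h \<in> functions_on (boundary E r n)"
    using h by (simp add: harmonic_iff)
  ultimately show "h \<in> span ((\<lambda>j. column j N) ` boundary E r n)"
    using mult_vec_in_span_columns[of "q_block n *v h" "boundary E r n" N] by simp
qed

section \<open>The boundary columns of the tree matrix as a basis\<close>

lemma inj_on_u_block: "inj_on ((*v) (u_block n)) (functions_on (levels_upto E r n))"
proof (rule inj_onI)
  fix x y
  assume x: "x \<in> functions_on (levels_upto E r n)" and y: "y \<in> functions_on (levels_upto E r n)"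
    and eq: "u_block n *v x = u_block n *v y"
  have "x - y = 0"
  proof (rule u_block_kernel)
    show "x - y \<in> functions_on (levels_upto E r n)"
      using x y by (rule subspace_diff[OF subspace_functions_on])
    show "u_block n *v (x - y) = 0" by (simp only: matrix_vector_mult_diff_distrib eq diff_self)
  qed
  then show "x = y" by simp
qed

lemma inj_on_column_u_block: "inj_on (\<lambda>j. column j (u_block n)) (boundary E r n)"
proof (rule inj_onI)
  fix j k
  assume jk: "j \<in> boundary E r n" "k \<in> boundary E r n"
    and "column j (u_block n) = column k (u_block n)"
  then have "u_block n *v axis j 1 = u_block n *v axis k 1"
    by (simp only: matrix_vector_mult_basis)
  then have "axis j 1 = (axis k 1 :: real^'a)"
    by (rule inj_onD[OF inj_on_u_block]) (use jk boundary_subset[of n] in \<open>auto simp: axis_in_functions_on\<close>)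
  then show "j = k" by (simp add: axis_eq_axis)
qed

lemma independent_column_u_block:
  "independent ((\<lambda>j. column j (u_block n)) ` boundary E r n)"
proof -
  let ?A = "(\<lambda>j. axis j 1 :: real^'a) ` boundary E r n"
  have "independent ?A"
    by (rule independent_mono[OF independent_Basis]) (auto simp: Basis_vec_def)
  moreover have "span ?A \<subseteq> functions_on (levels_upto E r n)"
    using boundary_subset[of n]
    by (intro span_minimal subspace_functions_on) (auto simp: axis_in_functions_on)
  ultimately have "independent ((*v) (u_block n) ` ?A)"
    by (intro linear_independent_injective_image matrix_vector_mul_linear
        inj_on_subset[OF inj_on_u_block])
  then show ?thesis unfolding image_image matrix_vector_mult_basis .
qed

text \<open>The columns are independent harmonic functions, as many as the dimension bound
  permits.\<close>

lemma span_column_u_block: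
  "span ((\<lambda>j. column j (u_block n)) ` boundary E r n) = harmonic_functions E r w n"
proof
  let ?B = "boundary E r n" and ?H = "harmonic_functions E r w n"
  let ?C = "(\<lambda>j. column j (u_block n)) ` ?B"
  have CH: "?C \<subseteq> ?H" using column_u_block_harmonic by blast
  then show "span ?C \<subseteq> ?H" by (intro span_minimal subspace_harmonic)
  obtain N where "is_inverse_on (levels_upto E r n) (q_matrix E r w) N"
    using invertible_q_block invertible_on_def by blast
  then have "dim ?H \<le> card ((\<lambda>j. column j N) ` ?B)"
    by (intro dim_le_card harmonic_span_inverse) auto
  also have "\<dots> \<le> card ?C" by (simp add: card_image_le card_image[OF inj_on_column_u_block])
  finally show "?H \<subseteq> span ?C"
    using CH independent_column_u_block by (intro card_ge_dim_independent)
qed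

text \<open>Here \<open>V = - N\<close>, so the matrix is \<open>H\<close>. As
  \<open>Q H x = - L U x\<close> for the blocks, a harmonic \<open>h\<close> equals
  \<open>H g\<close> once \<open>- L U g = Q h\<close>, and the block of \<open>U\<close> is
  invertible.\<close>

lemma harmonic_span_columns:
  assumes N: "is_inverse_on (levels_upto E r n) (q_matrix E r w) N"
  shows "span ((\<lambda>j. column j (u_block n + N)) ` levels_upto E r n) = harmonic_functions E r w n"
proof
  let ?J = "levels_upto E r n" and ?H = "u_block n + N"
  have Hx: "?H *v x \<in> functions_on ?J" for x
    unfolding matrix_vector_mult_add_rdistrib
    by (intro subspace_add[OF subspace_functions_on] restrict_matrix_mult_vec_in
        is_inverse_on_mult_vec_in[OF N])
  have QH: "(q_block n *v (?H *v x)) $ i = - leak n i * (u_block n *v x) $ i" for x i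
  proof -
    \<comment> \<open>This cancels the identity term of the block identity.\<close>
    have "q_block n *v (N *v x) = one_block n *v x"
      using N by (simp only: is_inverse_on_def matrix_vector_mul_assoc)
    then show ?thesis
      by (simp add: matrix_vector_mult_add_rdistrib matrix_vector_right_distrib
          q_block_mult_u_block_vec)
  qed
  have harm: "?H *v x \<in> harmonic_functions E r w n" for x
    unfolding harmonic_iff
  proof
    have "(u_block n *v x) $ i = 0" if "i \<notin> ?J" for i
      using that restrict_matrix_mult_vec_in[of ?J ?J "tree_matrix E r w" x]
      by (simp add: functions_on_def)
    then have "leak n i * (u_block n *v x) $ i = 0" if "i \<notin> boundary E r n" for i
      using leak_eq_0[of i n] that by (cases "i \<in> ?J") simp_all
    then show "q_block n *v (?H *v x) \<in> functions_on (boundary E r n)"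
      by (simp add: functions_on_def QH)
  qed (rule Hx)
  show "span ((\<lambda>j. column j ?H) ` ?J) \<subseteq> harmonic_functions E r w n"
    by (intro span_minimal subspace_harmonic image_subsetI)
      (simp only: matrix_vector_mult_basis[symmetric] harm)
  show "harmonic_functions E r w n \<subseteq> span ((\<lambda>j. column j ?H) ` ?J)"
  proof
    fix h assume h: "h \<in> harmonic_functions E r w n"
    \<comment> \<open>\<open>f\<close> solves \<open>- L f = Q h\<close>: the leak is positive on
      the boundary, and elsewhere the numerator is 0.\<close>
    define f where "f = (\<chi> i. - (q_block n *v h) $ i / leak n i)"
    have f: "f \<in> functions_on ?J"
      using h boundary_subset[of n] by (auto simp: f_def functions_on_def harmonic_iff)
    obtain M where M: "is_inverse_on ?J (tree_matrix E r w) M"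
      using invertible_u_block invertible_on_def by blast
    define g where "g = M *v f"
    have g: "g \<in> functions_on ?J"
      unfolding g_def using M by (rule is_inverse_on_mult_vec_in)
    have ug: "u_block n *v g = f"
      using M f by (simp add: g_def is_inverse_on_def matrix_vector_mul_assoc
          restrict_matrix_one_mult_vec)
    have "(q_block n *v (?H *v g)) $ i = (q_block n *v h) $ i" for i
    proof (cases "i \<in> boundary E r n")
      case True
      then show ?thesis using leak_pos[OF True] by (simp add: QH ug f_def)
    next
      case False
      \<comment> \<open>Both functions are harmonic, so both sides vanish off the boundary.\<close>
      then show ?thesis using h harm[of g] by (auto simp: harmonic_iff functions_on_def)
    qed
    then have "q_block n *v (h - ?H *v g) = 0"
      unfolding matrix_vector_mult_diff_distrib by (simp add: vec_eq_iff)
    moreover have "h - ?H *v g \<in> functions_on ?J"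
      using h Hx[of g] by (intro subspace_diff[OF subspace_functions_on]) (simp_all add: harmonic_iff)
    ultimately have "h - ?H *v g = 0" using q_block_kernel by blast
    then show "h \<in> span ((\<lambda>j. column j ?H) ` ?J)"
      using mult_vec_in_span_columns[OF g, of ?H] by simp
  qed
qed

end

theorem proposition2p4:
  fixes E :: "'a::finite graph" and r :: 'a and w :: "nat \<Rightarrow> real" and n :: nat
    and U Q V H :: "real^'a^'a" and I\<^sub>n B\<^sub>n :: "'a set"
  assumes "tree E"
    and "Max (range (level E r)) = n + 1"
    and "n \<ge> 1"
    and "weight_function E r w"
    and "U = tree_matrix E r w"
    and "Q = q_matrix E r w"
    and "I\<^sub>n = levels_upto E r n"
    and "B\<^sub>n = boundary E r n"
    and "V = - inverse_on I\<^sub>n Q"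
    and "H = restrict_matrix I\<^sub>n I\<^sub>n U - V"
  shows "invertible_on I\<^sub>n Q
    \<and> transpose H = H
    \<and> span ((\<lambda>j. column j H) ` I\<^sub>n) = harmonic_functions E r w n
    \<and> inj_on (\<lambda>j. column j (restrict_matrix I\<^sub>n B\<^sub>n U)) B\<^sub>n
    \<and> independent ((\<lambda>j. column j (restrict_matrix I\<^sub>n B\<^sub>n U)) ` B\<^sub>n)
    \<and> span ((\<lambda>j. column j (restrict_matrix I\<^sub>n B\<^sub>n U)) ` B\<^sub>n) = harmonic_functions E r w n"
proof -
  interpret weighted_tree E r w by unfold_locales fact+
  have N: "is_inverse_on I\<^sub>n Q (inverse_on I\<^sub>n Q)"
    using invertible_q_block assms by (auto intro: invertible_on_inverse)
  have H: "H = u_block n + inverse_on I\<^sub>n Q" using assms by simp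
  have col: "column j (restrict_matrix I\<^sub>n B\<^sub>n U) = column j (u_block n)" if "j \<in> B\<^sub>n" for j
    using that boundary_subset[of n] assms by (auto simp: column_def restrict_matrix_def vec_eq_iff)
  have "transpose (inverse_on I\<^sub>n Q) = inverse_on I\<^sub>n Q"
    using transpose_inverse_on[OF N] transpose_blocks assms by simp
  then have "transpose H = H"
    using transpose_blocks(2)[of n] by (simp add: H transpose_def vec_eq_iff)
  moreover have "span ((\<lambda>j. column j H) ` I\<^sub>n) = harmonic_functions E r w n"
    unfolding H using harmonic_span_columns N assms by simp
  \<comment> \<open>Independence concerns the set of columns; with injectivity the indexed family is
    a basis.\<close>
  moreover have "inj_on (\<lambda>j. column j (restrict_matrix I\<^sub>n B\<^sub>n U)) B\<^sub>n"
    using inj_on_column_u_block[of n] unfolding assms(8)[symmetric]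
    by (simp only: inj_on_cong[OF col])
  moreover have "(\<lambda>j. column j (restrict_matrix I\<^sub>n B\<^sub>n U)) ` B\<^sub>n
      = (\<lambda>j. column j (u_block n)) ` boundary E r n"
    using col assms(8) by (intro image_cong) simp_all
  moreover have "invertible_on I\<^sub>n Q" using invertible_q_block assms by simp
  ultimately show ?thesis
    using independent_column_u_block[of n] span_column_u_block[of n] by simp
qed

end
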